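(* Let $q\ge 5$ be an odd integer. For $n\ge 0$ let $s_n$ be the number of elements in row $n$ of the hyperbolic Pascal triangle linked to the mosaic $\{4,q\}$, let $a_{n,i}$ ($0\le i\le s_n-1$) be the $i$-th element of row $n$, and let $\widetilde{s}_n=\sum_{i=0}^{s_n-1}(-1)^i a_{n,i}$. Then $\widetilde{s}_0=1$, and $$ \widetilde{s}_n=\begin{cases} 0, & \text{if } n=3t+1,\ n\ge 1,\\ (-2)^t(q-5)^{t-1}+2, & \text{if } n=3t-1,\ n\ge n_1,\\ 2(-2)^t(q-5)^{t-1}+2, & \text{if } n=3t,\ n\ge n_2, \end{cases} $$ where $t$ denotes an integer, and $(n_1,n_2)=(2,3)$ if $q>5$, while $(n_1,n_2)=(5,6)$ if $q=5$. Moreover, in the case $q=5$ one has $\widetilde{s}_2=0$ and $\widetilde{s}_3=-2$.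
   Context: Fix an integer $q\ge5$. The hyperbolic Pascal triangle linked to the regular mosaic $\{4,q\}$ consists of rows $n=0,1,2,\dots$; row $n$ is a finite sequence of vertices listed from left to right and indexed $0,1,\dots,s_n-1$, where $s_n$ is the number of vertices in row $n$. Each vertex has a type (base vertex, winger, $A$ or $B$) and a positive integer value; the value of the $i$-th vertex of row $n$ (the "$i$-th element" of row $n$) is denoted $a_{n,i}$. The rows are built as follows. - Row $0$ consists only of the base vertex, of value $1$. Row $1$ consists of two wingers, each of value $1$. - For $n\ge1$, the first and last vertices of row $n$ are the wingers and all other vertices have type $A$ or $B$. Each winger has $2$ descendants in row $n+1$, each type $A$ vertex has $q-2$, and each type $B$ vertex has $q-1$. The descendants of a vertex are placed from left to right, in the order of the vertices of row $n$. For any two neighbouring vertices of row $n$, the rightmost descendant of the left one and the leftmost descendant of the right one coincide; this common vertex of row $n+1$ has type $A$, and its value is the sum of the values of its two ascendants. The leftmost descendant of the left winger and the rightmost descendant of the right winger are the wingers of row $n+1$, each of value $1$. All remaining vertices of row $n+1$ have a single ascendant, have type $B$, and have the same value as that ascendant. Equivalently, for $n\ge 1$, row $n+1$ is obtained from row $n$, read left to right, as follows: start with a winger $1$; between the contributions of each two neighbouring vertices with values $x,y$ put one type $A$ vertex of value $x+y$; each type $A$ vertex of value $x$ contributes $q-4$ consecutive type $B$ vertices of value $x$, each type $B$ vertex of value $x$ contributes $q-3$ consecutive type $B$ vertices of value $x$, and wingers contribute no type $B$ vertices; end with a winger $1$. For example, row $2$ is $1,2,1$ (the $2$ being of type $A$),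 and row $3$ is $1,3,2,\dots,2,3,1$ with $q-4$ copies of $2$ (the $3$'s of type $A$, the $2$'s of type $B$). The value of a vertex equals the number of shortest paths to it from the base vertex. *)

theory Defs
  imports Main
begin

datatype vertex_type = Base | Winger | TypeA | TypeB

type_synonym vertex = "vertex_type \<times> nat"  (* type and value of a vertex *)

fun num_desc :: "nat \<Rightarrow> vertex_type \<Rightarrow> nat" where
  "num_desc q Base = 2"
| "num_desc q Winger = 2"
| "num_desc q TypeA = q - 2"
| "num_desc q TypeB = q - 1"

(* The leftmost and the rightmost descendant of a vertex are each either shared with a
   neighbour of that vertex or a winger.  The other descendants have this vertex as their
   single ascendant. *)
definition own_desc :: "nat \<Rightarrow> vertex \<Rightarrow> vertex list" where
  "own_desc q v = replicate (num_desc q (fst v) - 2) (TypeB, snd v)"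

(* The next row without its two wingers. *)
fun inner_desc :: "nat \<Rightarrow> vertex list \<Rightarrow> vertex list" where
  "inner_desc q [] = []"
| "inner_desc q [v] = own_desc q v"
| "inner_desc q (v # w # vs) =
     own_desc q v @ (TypeA, snd v + snd w) # inner_desc q (w # vs)"

definition next_row :: "nat \<Rightarrow> vertex list \<Rightarrow> vertex list" where
  "next_row q vs = (Winger, 1) # inner_desc q vs @ [(Winger, 1)]"

(* Row n, from left to right, of the hyperbolic Pascal triangle linked to {4,q}; the
   subtractions in num_desc and own_desc do not truncate for q \<ge> 5. *)
primrec hpt_row :: "nat \<Rightarrow> nat \<Rightarrow> vertex list" where
  "hpt_row q 0 = [(Base, 1)]"
| "hpt_row q (Suc n) = next_row q (hpt_row q n)"

definition row_size :: "nat \<Rightarrow> nat \<Rightarrow> nat" where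
  "row_size q n = length (hpt_row q n)"

definition hpt_elem :: "nat \<Rightarrow> nat \<Rightarrow> nat \<Rightarrow> nat" where
  "hpt_elem q n i = snd (hpt_row q n ! i)"

definition alt_sum :: "nat \<Rightarrow> nat \<Rightarrow> int" where
  "alt_sum q n = (\<Sum>i<row_size q n. (-1) ^ i * int (hpt_elem q n i))"

lemma hpt_row_1: "hpt_row q 1 = [(Winger, 1), (Winger, 1)]"
  by (simp add: next_row_def own_desc_def)

lemma hpt_row_2: "hpt_row q 2 = [(Winger, 1), (TypeA, 2), (Winger, 1)]"
  by (simp add: numeral_2_eq_2 next_row_def own_desc_def)

lemma hpt_row_3:
  "hpt_row q 3 =
     [(Winger, 1), (TypeA, 3)] @ replicate (q - 4) (TypeB, 2) @ [(TypeA, 3), (Winger, 1)]"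
  by (simp add: numeral_3_eq_3 next_row_def own_desc_def)

end

(* Write a row as a winger, an inner part us, and a winger.  Besides the alternating sum of us, follow
   three more signed sums: the A vertices signed by the parity of the number of preceding B
   vertices, the B vertices signed by the parity of the number of preceding A vertices, and the
   B vertices signed by position.  For odd q an A vertex has an odd number of own descendants
   and a B vertex an even number, so that passing to the next row permutes these sums up to simple terms.
   Three steps give s(n+3) = -2(q-5) s(n) + (2q-9)(1 - (-1)^|us|), and the parity of |us|
   has period 3 in n. *)
theory Submission
  imports Defs
begin

section \<open>Signed sums over rows, and the inner parts of rows\<close>

text \<open>Each vertex ends up multiplied by the product of \<open>\<sigma>\<close> over all
  vertices before it: the parity of its position for \<open>alt\<close>, the parity of the number of
  preceding \<open>T\<close> vertices for \<open>flip T\<close>.\<close>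

fun wsum :: "(vertex_type \<Rightarrow> int) \<Rightarrow> (vertex_type \<Rightarrow> int) \<Rightarrow> vertex list \<Rightarrow> int" where
  "wsum c \<sigma> [] = 0"
| "wsum c \<sigma> (v # vs) = c (fst v) * int (snd v) + \<sigma> (fst v) * wsum c \<sigma> vs"

text \<open>The sign that \<open>vs\<close> passes on to whatever follows it in a
  \<open>wsum\<close>.\<close>

definition sign_prod :: "(vertex_type \<Rightarrow> int) \<Rightarrow> vertex list \<Rightarrow> int" where
  "sign_prod \<sigma> vs = prod_list (map (\<sigma> \<circ> fst) vs)"

definition only :: "vertex_type \<Rightarrow> vertex_type \<Rightarrow> int" where
  "only T U = (if U = T then 1 else 0)"

definition flip :: "vertex_type \<Rightarrow> vertex_type \<Rightarrow> int" where
  "flip T U = (if U = T then -1 else 1)"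

abbreviation every :: "vertex_type \<Rightarrow> int" where "every \<equiv> \<lambda>_. 1"
abbreviation alt :: "vertex_type \<Rightarrow> int" where "alt \<equiv> \<lambda>_. -1"

abbreviation winger :: vertex where "winger \<equiv> (Winger, 1)"

definition inner_vertices :: "vertex list \<Rightarrow> bool" where
  "inner_vertices us \<longleftrightarrow> fst ` set us \<subseteq> {TypeA, TypeB}"

text \<open>The wingers are fixed, so the inner part alone determines its successor; iterating from
  \<open>[]\<close> yields all rows from row 1 on.\<close>

definition next_inner :: "nat \<Rightarrow> vertex list \<Rightarrow> vertex list" where
  "next_inner q us = inner_desc q (winger # us @ [winger])"

lemma sign_prod_simps [simp]:
  "sign_prod \<sigma> [] = 1"
  "sign_prod \<sigma> (v # vs) = \<sigma> (fst v) * sign_prod \<sigma> vs"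
  "sign_prod \<sigma> (us @ vs) = sign_prod \<sigma> us * sign_prod \<sigma> vs"
  "sign_prod \<sigma> (replicate n v) = \<sigma> (fst v) ^ n"
  by (simp_all add: sign_prod_def)

lemma wsum_append [simp]: "wsum c \<sigma> (us @ vs) = wsum c \<sigma> us + sign_prod \<sigma> us * wsum c \<sigma> vs"
  by (induction us) (auto simp: algebra_simps)

lemma wsum_replicate_const:
  "\<sigma> (fst v) = 1 \<Longrightarrow> wsum c \<sigma> (replicate n v) = int n * c (fst v) * int (snd v)"
  by (induction n) (auto simp: algebra_simps)

lemma wsum_replicate_alt:
  "\<sigma> (fst v) = -1 \<Longrightarrow>
    wsum c \<sigma> (replicate n v) = (if odd n then c (fst v) * int (snd v) else 0)"
  by (induction n) auto

lemma alternating_sum_eq_wsum: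
  "(\<Sum>i<length vs. (-1) ^ i * int (snd (vs ! i))) = wsum every alt vs"
proof (induction vs)
  case (Cons v vs)
  then show ?case
    by (simp only: length_Cons sum.lessThan_Suc_shift) (simp add: sum_negf)
qed simp

lemma inner_vertices_simps [simp]:
  "inner_vertices []"
  "inner_vertices (v # vs) \<longleftrightarrow> (fst v = TypeA \<or> fst v = TypeB) \<and> inner_vertices vs"
  "inner_vertices (us @ vs) \<longleftrightarrow> inner_vertices us \<and> inner_vertices vs"
  by (auto simp: inner_vertices_def)

lemma inner_desc_Cons:
  "xs \<noteq> [] \<Longrightarrow>
    inner_desc q (v # xs) = own_desc q v @ (TypeA, snd v + snd (hd xs)) # inner_desc q xs"
  by (cases xs) auto

lemma own_desc_eq:
  "own_desc q (TypeA, x) = replicate (q - 4) (TypeB, x)"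
  "own_desc q (TypeB, x) = replicate (q - 3) (TypeB, x)"
  "own_desc q (Winger, x) = []"
  by (simp_all add: own_desc_def)

lemma next_inner_eq:
  "next_inner q us = (TypeA, 1 + snd (hd (us @ [winger]))) # inner_desc q (us @ [winger])"
  by (simp add: next_inner_def inner_desc_Cons own_desc_eq)

lemma inner_vertices_inner_desc: "inner_vertices (inner_desc q vs)"
  by (induction q vs rule: inner_desc.induct) (auto simp: inner_vertices_def own_desc_def)

lemma inner_vertices_next_inner: "inner_vertices (next_inner q us)"
  by (simp add: next_inner_def inner_vertices_inner_desc)

lemma hpt_row_Suc: "hpt_row q (Suc n) = winger # (next_inner q ^^ n) [] @ [winger]"
proof (induction n)
  case 0
  then show ?case using hpt_row_1 by simp
next
  case (Suc n)
  have "hpt_row q (Suc (Suc n)) = next_row q (hpt_row q (Suc n))"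
    by (rule hpt_row.simps)
  with Suc show ?case by (simp add: next_row_def next_inner_def)
qed

section \<open>Effect of one step on signs and sums\<close>

text \<open>Each vertex of \<open>us\<close> yields a block: its own B vertices, then one A. For odd
  \<open>q\<close> an A vertex owns \<open>q - 4\<close> of them, an odd number, and a B vertex
  \<open>q - 3\<close>, an even number. So blocks of A have even length, blocks of B odd
  length.\<close>

lemma inner_desc_signs:
  assumes "inner_vertices us" and "odd q" "q \<ge> 5"
  shows "sign_prod alt (inner_desc q (us @ [winger])) = sign_prod (flip TypeB) us"
    and "sign_prod (flip TypeB) (inner_desc q (us @ [winger])) = sign_prod (flip TypeA) us"
    and "sign_prod (flip TypeA) (inner_desc q (us @ [winger])) = sign_prod alt us"
proof -
  have "sign_prod alt (inner_desc q (us @ [winger])) = sign_prod (flip TypeB) us \<and>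
    sign_prod (flip TypeB) (inner_desc q (us @ [winger])) = sign_prod (flip TypeA) us \<and>
    sign_prod (flip TypeA) (inner_desc q (us @ [winger])) = sign_prod alt us"
    using assms
  proof (induction us)
    case (Cons v us)
    then show ?case
      by (cases v) (auto simp: inner_desc_Cons own_desc_eq flip_def)
  qed (simp add: own_desc_eq)
  then show "sign_prod alt (inner_desc q (us @ [winger])) = sign_prod (flip TypeB) us"
    and "sign_prod (flip TypeB) (inner_desc q (us @ [winger])) = sign_prod (flip TypeA) us"
    and "sign_prod (flip TypeA) (inner_desc q (us @ [winger])) = sign_prod alt us"
    by auto
qed

text \<open>The value x of a vertex enters its own copies and the A vertices on both sides of them.
  For a B vertex those two have opposite signs and the copies cancel. For an A vertex they share a
  sign s and the copies leave -s*x, in total s*x. The \<open>hd\<close> term makes up for the A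
  vertex missing at the left end; the last term is the share of the right winger.\<close>

lemma inner_desc_alternating_sum:
  assumes "inner_vertices us" and "odd q" "q \<ge> 5"
  shows "wsum every alt (inner_desc q (us @ [winger])) =
    int (snd (hd (us @ [winger]))) - wsum (only TypeA) (flip TypeB) us - sign_prod (flip TypeB) us"
  using assms
proof (induction us)
  case (Cons v us)
  then show ?case
    by (cases v) (auto simp: inner_desc_Cons own_desc_eq flip_def only_def wsum_replicate_alt)
qed (simp add: own_desc_eq)

text \<open>The two A vertices that receive the value of a vertex are separated by its own B
  vertices: their shares cancel for an A ascendant and double for a B ascendant.\<close>

lemma inner_desc_A_sum:
  assumes "inner_vertices us" and "odd q" "q \<ge> 5"
  shows "wsum (only TypeA) (flip TypeB) (inner_desc q (us @ [winger])) =
    2 * wsum (only TypeB) (flip TypeA) us + sign_prod (flip TypeA) us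
      - int (snd (hd (us @ [winger])))"
  using assms
proof (induction us)
  case (Cons v us)
  then show ?case
    by (cases v) (auto simp: inner_desc_Cons own_desc_eq flip_def only_def wsum_replicate_alt)
qed (simp add: own_desc_eq)

text \<open>Each block contains one A, so the sign alternates from block to block; B ascendants have
  one copy more than A ascendants.\<close>

lemma inner_desc_B_sum:
  assumes "inner_vertices us" and "odd q" "q \<ge> 5"
  shows "wsum (only TypeB) (flip TypeA) (inner_desc q (us @ [winger])) =
    (int q - 4) * wsum every alt us + wsum (only TypeB) alt us"
  using assms
proof (induction us)
  case (Cons v us)
  then show ?case
    by (cases v)
      (auto simp: inner_desc_Cons own_desc_eq flip_def only_def wsum_replicate_const of_nat_diff
        algebra_simps)
qed (simp add: own_desc_eq)

text \<open>The copies of a B ascendant cancel, those of an A ascendant leave one; only the blocks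
  of B ascendants, being of odd length, change the sign.\<close>

lemma inner_desc_alternating_B_sum:
  assumes "inner_vertices us" and "odd q" "q \<ge> 5"
  shows "wsum (only TypeB) alt (inner_desc q (us @ [winger])) = wsum (only TypeA) (flip TypeB) us"
  using assms
proof (induction us)
  case (Cons v us)
  then show ?case
    by (cases v) (auto simp: inner_desc_Cons own_desc_eq flip_def only_def wsum_replicate_alt)
qed (simp add: own_desc_eq)

text \<open>The A vertex next to the left winger absorbs the \<open>hd\<close> terms and reverses
  the later signs that depend on position or on the number of A vertices.\<close>

lemma next_inner_step:
  assumes "inner_vertices us" and "odd q" "q \<ge> 5"
  shows next_inner_signs:
      "sign_prod alt (next_inner q us) = - sign_prod (flip TypeB) us"
      "sign_prod (flip TypeB) (next_inner q us) = sign_prod (flip TypeA) us"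
      "sign_prod (flip TypeA) (next_inner q us) = - sign_prod alt us"
    and next_inner_sums:
      "wsum every alt (next_inner q us) =
        1 + wsum (only TypeA) (flip TypeB) us + sign_prod (flip TypeB) us"
      "wsum (only TypeA) (flip TypeB) (next_inner q us) =
        1 + 2 * wsum (only TypeB) (flip TypeA) us + sign_prod (flip TypeA) us"
      "wsum (only TypeB) (flip TypeA) (next_inner q us) =
        - (int q - 4) * wsum every alt us - wsum (only TypeB) alt us"
      "wsum (only TypeB) alt (next_inner q us) = - wsum (only TypeA) (flip TypeB) us"
  using inner_desc_signs[OF assms] inner_desc_alternating_sum[OF assms]
    inner_desc_A_sum[OF assms] inner_desc_B_sum[OF assms] inner_desc_alternating_B_sum[OF assms]
  by (simp_all add: next_inner_eq flip_def only_def algebra_simps)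

section \<open>Alternating sums of rows and their recurrence\<close>

lemma inner_vertices_funpow: "inner_vertices ((next_inner q ^^ n) [])"
  by (cases n) (simp_all add: inner_vertices_next_inner)

lemma alt_sum_eq_wsum: "alt_sum q n = wsum every alt (hpt_row q n)"
  by (simp add: alt_sum_def row_size_def hpt_elem_def alternating_sum_eq_wsum)

lemma alt_sum_Suc:
  "alt_sum q (Suc n) =
    1 - wsum every alt ((next_inner q ^^ n) []) - sign_prod alt ((next_inner q ^^ n) [])"
  by (simp add: alt_sum_eq_wsum hpt_row_Suc del: hpt_row.simps)

text \<open>The winger terms of the row cancel the constant and the sign product produced by the
  step.\<close>

lemma alt_sum_Suc_Suc:
  assumes "odd q" "q \<ge> 5"
  shows "alt_sum q (Suc (Suc n)) = - wsum (only TypeA) (flip TypeB) ((next_inner q ^^ n) [])"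
  by (simp add: alt_sum_Suc next_inner_step[OF inner_vertices_funpow assms])

text \<open>Both sides are the negated A sum of the preceding inner part; for \<open>n = 0\<close>
  both vanish.\<close>

lemma alternating_B_sum_eq_alt_sum:
  assumes "odd q" "q \<ge> 5"
  shows "wsum (only TypeB) alt ((next_inner q ^^ n) []) = alt_sum q (Suc n)"
proof (cases n)
  case 0
  then show ?thesis by (simp add: alt_sum_Suc)
next
  case (Suc m)
  then show ?thesis
    using next_inner_sums(4)[OF inner_vertices_funpow assms] alt_sum_Suc_Suc[OF assms] by simp
qed

lemma alt_sum_recurrence:
  assumes "odd q" "q \<ge> 5"
  shows "alt_sum q (n + 4) = - 2 * (int q - 5) * alt_sum q (n + 1)
    + (2 * int q - 9) * (1 - sign_prod alt ((next_inner q ^^ n) []))"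
proof -
  let ?us = "(next_inner q ^^ n) []"
  note step = next_inner_step[OF _ assms]
  have "alt_sum q (n + 4) = - wsum (only TypeA) (flip TypeB) (next_inner q (next_inner q ?us))"
    using alt_sum_Suc_Suc[OF assms, of "n + 2"] by (simp add: numeral_eq_Suc)
  also have "\<dots> = 2 * (int q - 4) * wsum every alt ?us + 2 * wsum (only TypeB) alt ?us
      + sign_prod alt ?us - 1"
    by (simp add: step inner_vertices_next_inner inner_vertices_funpow algebra_simps)
  also have "wsum (only TypeB) alt ?us = alt_sum q (n + 1)"
    using alternating_B_sum_eq_alt_sum[OF assms] by simp
  \<comment> \<open>After this substitution \<open>alt_sum q (n + 1)\<close> has coefficient -2(q-4)
    + 2 = -2(q-5).\<close>
  also have "wsum every alt ?us = 1 - sign_prod alt ?us - alt_sum q (n + 1)"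
    by (simp add: alt_sum_Suc)
  finally show ?thesis by (simp add: algebra_simps)
qed

section \<open>Parity of the row length and the closed form\<close>

text \<open>A step permutes the three sign products cyclically, and a full cycle collects two minus
  signs.\<close>

lemma sign_prod_alt_period:
  assumes "odd q" "q \<ge> 5"
  shows "sign_prod alt ((next_inner q ^^ (n + 3)) []) = sign_prod alt ((next_inner q ^^ n) [])"
  by (simp add: numeral_3_eq_3 next_inner_signs[OF _ assms] inner_vertices_next_inner
      inner_vertices_funpow)

lemma sign_prod_alt_funpow:
  assumes "odd q" "q \<ge> 5"
  shows "sign_prod alt ((next_inner q ^^ (3 * t)) []) = 1"
    and "sign_prod alt ((next_inner q ^^ (3 * t + 1)) []) = -1"
    and "sign_prod alt ((next_inner q ^^ (3 * t + 2)) []) = -1"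
proof (induction t)
  case 0
  {
    case 1 show ?case by simp
  next
    case 2 show ?case using next_inner_signs[OF _ assms, of "[]"] by simp
  next
    case 3 show ?case
      using next_inner_signs[OF _ assms] by (simp add: numeral_2_eq_2 inner_vertices_next_inner)
  }
next
  case (Suc t)
  note period = sign_prod_alt_period[OF assms]
  {
    case 1 show ?case using Suc(1) period[of "3 * t"] by (simp add: add.commute)
  next
    case 2 show ?case using Suc(2) period[of "3 * t + 1"] by (simp add: ac_simps)
  next
    case 3 show ?case using Suc(3) period[of "3 * t + 2"] by (simp add: ac_simps)
  }
qed

lemma alt_sum_initial:
  assumes "odd q" "q \<ge> 5"
  shows "alt_sum q 0 = 1" "alt_sum q 1 = 0" "alt_sum q 2 = 0" "alt_sum q 3 = -2"
proof -
  show "alt_sum q 0 = 1" "alt_sum q 1 = 0" "alt_sum q 2 = 0"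
    by (simp_all only: alt_sum_eq_wsum hpt_row_1 hpt_row_2) simp_all
  have "odd (q - 4)" using assms by simp
  then show "alt_sum q 3 = -2"
    by (simp only: alt_sum_eq_wsum hpt_row_3) (simp add: wsum_replicate_alt)
qed

text \<open>In the recurrence the inhomogeneous term is 0 for \<open>n = 3 * t\<close> and 2(2q-9)
  otherwise. In the latter case 2 is a fixed point, so the difference from 2 is multiplied by
  -2(q-5). For \<open>q = 5\<close> the case \<open>t = 0\<close> reads
  \<open>0 ^ 0 = 1\<close>.\<close>

lemma alt_sum_closed_form:
  assumes "odd q" "q \<ge> 5"
  shows "alt_sum q (3 * t + 1) = 0"
    and "alt_sum q (3 * t + 2) = (-2) ^ (t + 1) * (int q - 5) ^ t + 2"
    and "alt_sum q (3 * t + 3) = 2 * (-2) ^ (t + 1) * (int q - 5) ^ t + 2"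
proof (induction t)
  case 0
  {
    case 1 show ?case using alt_sum_initial[OF assms] by simp
  next
    case 2 show ?case using alt_sum_initial(3)[OF assms] by (simp add: numeral_2_eq_2)
  next
    case 3 show ?case using alt_sum_initial[OF assms] by simp
  }
next
  case (Suc t)
  \<comment> \<open>These bring the indices to the form \<open>n + 4\<close> of the recurrence, and
    its \<open>n + 1\<close> to the form of the induction hypotheses.\<close>
  have shift: "3 * Suc t + 1 = 3 * t + 4" "3 * Suc t + 2 = 3 * t + 1 + 4"
    "3 * Suc t + 3 = 3 * t + 2 + 4" "3 * t + 1 + 1 = 3 * t + 2" "3 * t + 2 + 1 = 3 * t + 3"
    by simp_all
  note rec = alt_sum_recurrence[OF assms] sign_prod_alt_funpow[OF assms]
  {
    case 1 show ?case unfolding shift rec Suc by simp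
  next
    case 2 show ?case unfolding shift rec Suc by (simp add: algebra_simps)
  next
    case 3 show ?case unfolding shift rec Suc by (simp add: algebra_simps)
  }
qed

theorem theorem2:
  fixes q :: nat and n1 n2 :: nat
  assumes "q \<ge> 5" and "odd q"
    and "(n1, n2) = (if q > 5 then (2, 3) else (5, 6))"
  shows "alt_sum q 0 = 1 \<and>
    (\<forall>n t :: nat.
       (n = 3 * t + 1 \<and> n \<ge> 1 \<longrightarrow> alt_sum q n = 0) \<and>
       (n + 1 = 3 * t \<and> n \<ge> n1 \<longrightarrow>
          alt_sum q n = (-2) ^ t * (int q - 5) ^ (t - 1) + 2) \<and>
       (n = 3 * t \<and> n \<ge> n2 \<longrightarrow>
          alt_sum q n = 2 * (-2) ^ t * (int q - 5) ^ (t - 1) + 2)) \<and>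
    (q = 5 \<longrightarrow> alt_sum q 2 = 0 \<and> alt_sum q 3 = -2)"
proof (intro conjI allI impI)
  note closed = alt_sum_closed_form[OF assms(2,1)]
  fix n t :: nat
  show "alt_sum q n = 0" if "n = 3 * t + 1 \<and> n \<ge> 1"
    using that closed(1) by simp
  show "alt_sum q n = (-2) ^ t * (int q - 5) ^ (t - 1) + 2" if n: "n + 1 = 3 * t \<and> n \<ge> n1"
  proof -
    obtain u where "t = Suc u" using n by (cases t) auto
    moreover from this n have "n = 3 * u + 2" by simp
    ultimately show ?thesis using closed(2)[of u] by simp
  qed
  show "alt_sum q n = 2 * (-2) ^ t * (int q - 5) ^ (t - 1) + 2" if n: "n = 3 * t \<and> n \<ge> n2"
  proof -
    \<comment> \<open>This excludes row 0, where \<open>t = 0\<close> and \<open>t - 1\<close> would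
      truncate.\<close>
    have "n2 > 0" using assms(3) by (simp split: if_splits)
    then obtain u where "t = Suc u" using n by (cases t) auto
    moreover from this n have "n = 3 * u + 3" by simp
    ultimately show ?thesis using closed(3)[of u] by simp
  qed
qed (use alt_sum_initial[OF assms(2,1)] in simp_all)

end
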